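(* Let $d\ge2$. For anti-de Sitter space $M=\mathrm{AdS}^d$, with the causal structure, Euler element $h$, positive tube domain $\mathcal T_M^+$ and maps $\kappa_h,\overline\tau_h$ described in the context, we have the equalities $$W_M^+(h)=W_M^{\rm KMS}(h)=\kappa_h\big((\mathcal T_M^+)^{\overline\tau_h}\big)=W_M(h).$$
   Context: $V=\mathbb R^{d+1}$ with basis $e_0,\dots,e_d$ and $\beta(x,y)=x_0y_0+x_1y_1-x_2y_2-\cdots-x_dy_d$, extended complex bilinearly to $V_{\mathbb C}=\mathbb C^{d+1}$. $G=\mathrm{SO}_{2,d-1}(\mathbb R)_e$ is the identity component of the special orthogonal group of $\beta$, and $M=\mathrm{AdS}^d=\{x\in V:\beta(x,x)=1\}=G.e_0$. $T_p(M)=p^\perp$ (with respect to $\beta$). Causal structure: $V_+(e_0)=\{x\in e_0^\perp:\beta(x,x)>0,\ \beta(x,e_1)>0\}$ and $V_+(g.e_0)=g.V_+(e_0)\subseteq T_{g.e_0}(M)$, $g\in G$ (well defined). Exponential map: $\mathrm{Exp}_p(v)=C(\beta(v,v))p+S(\beta(v,v))v$ with entire functions $C,S$ determined by $C(z^2)=\cos z$, $S(z^2)=\frac{\sin z}{z}$. Modular flow: $h\in\mathfrak{so}_{2,d-1}(\mathbb R)$, $hx=(0,x_2,x_1,0,\dots,0)$; $X_h(x)=hx$; $\alpha_z=e^{zh}$ for $z\in\mathbb C$, acting on $V_{\mathbb C}$; $\alpha_t$ ($t\in\mathbb R$) preserves $M$, with fixed point set $M^\alpha$. $\tau_h=e^{\pi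 ih}$, i.e. $\tau_h(x)=(x_0,-x_1,-x_2,x_3,\dots,x_d)$; $\overline\tau_h$ is its antilinear extension to $V_{\mathbb C}$; $\kappa_h=e^{-\frac{\pi i}{2}h}$, i.e. $\kappa_h(x)=(x_0,-ix_2,-ix_1,x_3,\dots,x_d)$. Tube domain: $M_{\mathbb C}=\{z\in V_{\mathbb C}:\beta(z,z)=1\}$. For $z=x+iy\in M_{\mathbb C}$ with $x,y\in V$ and $\beta(y,y)>0$ one has $\beta(x,x)=1+\beta(y,y)>1$ and $\beta(x,y)=0$, so $\tilde x=\beta(x,x)^{-1/2}x\in M$ and $y\in T_{\tilde x}(M)$. $\mathcal T_M^+$ is the set of those $z=x+iy\in M_{\mathbb C}$ with $\beta(y,y)>0$ for which $y\in V_+(\tilde x)$. $(\mathcal T_M^+)^{\overline\tau_h}$ is its subset of $\overline\tau_h$-fixed points. Wedge domains: $W_M^+(h)=\{x\in M:X_h(x)\in V_+(x)\}$; $W_M^{\rm KMS}(h)=\{x\in M:\alpha_{it}(x)\in\mathcal T_M^+\ \text{for all }t\in(0,\pi)\}$; $W_M(h)=\bigcup_{m\in M^\alpha}\mathrm{Exp}_m(C_m^{c,0})$, where $C_m=\overline{V_+(m)}$, $T_m(M)_{j}$ is the $j$-eigenspace of $h$ on $T_m(M)$, $C_m^c=C_m\cap T_m(M)_1-C_m\cap T_m(M)_{-1}$, and $C_m^{c,0}$ is its interior in $T_m(M)_1+T_m(M)_{-1}$. *)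

theory Defs
  imports "HOL-Complex_Analysis.Complex_Analysis"
begin

text \<open>
  \<open>V = \<real>\<^sup>d\<^sup>+\<^sup>1\<close> is \<^typ>\<open>real ^ 'n\<close> and \<open>V\<^sub>\<complex>\<close> is \<^typ>\<open>complex ^ 'n\<close>. The parameter
  \<open>ix :: nat \<Rightarrow> 'n\<close> is the numbering of the coordinates; it is only meaningful under the
  assumption \<^prop>\<open>bij_betw ix {0..d} UNIV\<close> (whence \<^prop>\<open>CARD('n) = d + 1\<close>), and the basis vector
  \<open>e\<^sub>i\<close> is \<^term>\<open>axis (ix i) 1\<close>. The bilinear form and \<open>h\<close> are stated for any coefficient
  ring, so that the complex instance is the complex linear extension of the real one.
\<close>

definition \<beta> :: "(nat \<Rightarrow> 'n::finite) \<Rightarrow> 'a::comm_ring_1 ^ 'n \<Rightarrow> 'a ^ 'n \<Rightarrow> 'a" where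
  "\<beta> ix x y = x $ ix 0 * y $ ix 0 + x $ ix 1 * y $ ix 1
     - (\<Sum>j\<in>UNIV - {ix 0, ix 1}. x $ j * y $ j)"

definition complexify :: "real ^ 'n \<Rightarrow> complex ^ 'n" where
  "complexify x = (\<chi> j. complex_of_real (x $ j))"

definition re_part :: "complex ^ 'n \<Rightarrow> real ^ 'n" where
  "re_part z = (\<chi> j. Re (z $ j))"

definition im_part :: "complex ^ 'n \<Rightarrow> real ^ 'n" where
  "im_part z = (\<chi> j. Im (z $ j))"

definition cnj_vec :: "complex ^ 'n \<Rightarrow> complex ^ 'n" where
  "cnj_vec z = (\<chi> j. cnj (z $ j))"


subsection \<open>The group, anti-de Sitter space and its causal structure\<close>

definition SO_group :: "(nat \<Rightarrow> 'n::finite) \<Rightarrow> (real ^ 'n ^ 'n) set" where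
  "SO_group ix = {g. (\<forall>x y. \<beta> ix (g *v x) (g *v y) = \<beta> ix x y) \<and> det g = 1}"

definition G_group :: "(nat \<Rightarrow> 'n::finite) \<Rightarrow> (real ^ 'n ^ 'n) set" where
  "G_group ix = connected_component_set (SO_group ix) (mat 1)"

definition AdS :: "(nat \<Rightarrow> 'n::finite) \<Rightarrow> (real ^ 'n) set" where
  "AdS ix = {x. \<beta> ix x x = 1}"

definition tangent :: "(nat \<Rightarrow> 'n::finite) \<Rightarrow> real ^ 'n \<Rightarrow> (real ^ 'n) set" where
  "tangent ix p = {v. \<beta> ix p v = 0}"

definition Vplus_base :: "(nat \<Rightarrow> 'n::finite) \<Rightarrow> (real ^ 'n) set" where
  "Vplus_base ix =
     {x \<in> tangent ix (axis (ix 0) 1). \<beta> ix x x > 0 \<and> \<beta> ix x (axis (ix 1) 1) > 0}"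

text \<open>
  The cone at \<open>g.e\<^sub>0\<close> is \<open>g.V\<^sub>+(e\<^sub>0)\<close>. The cone at \<open>e\<^sub>0\<close> is invariant under the stabilizer of
  \<open>e\<^sub>0\<close> in \<open>G\<close>, so for \<open>p\<close> in AdS all the sets in the following union coincide.
\<close>
definition Vplus :: "(nat \<Rightarrow> 'n::finite) \<Rightarrow> real ^ 'n \<Rightarrow> (real ^ 'n) set" where
  "Vplus ix p =
     (\<Union>g \<in> {g \<in> G_group ix. g *v axis (ix 0) 1 = p}. (\<lambda>v. g *v v) ` Vplus_base ix)"


subsection \<open>The exponential map\<close>

definition entire_C :: "complex \<Rightarrow> complex" where
  "entire_C = (THE f. f holomorphic_on UNIV \<and> (\<forall>z. f (z\<^sup>2) = cos z))"

definition entire_S :: "complex \<Rightarrow> complex" where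
  "entire_S = (THE f. f holomorphic_on UNIV \<and> (\<forall>z. z \<noteq> 0 \<longrightarrow> f (z\<^sup>2) = sin z / z))"

lemma entire_if_power_series:
  fixes a :: "nat \<Rightarrow> complex"
  assumes "\<And>w. (\<lambda>n. a n * w ^ n) sums f w"
  shows "f holomorphic_on UNIV"
proof -
  have "f field_differentiable (at w)" for w
  proof -
    have "f holomorphic_on ball 0 (norm w + 1)"
      by (rule power_series_holomorphic[of 0 _ a]) (use assms in simp)
    then show ?thesis
      by (rule holomorphic_on_imp_differentiable_at) auto
  qed
  then show ?thesis
    by (simp add: holomorphic_on_def)
qed

lemma ex1_entire_C: "\<exists>!f. f holomorphic_on UNIV \<and> (\<forall>z. f (z\<^sup>2) = cos (z::complex))"
proof (rule ex_ex1I)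
  define a :: "nat \<Rightarrow> complex" where "a n = of_real (cos_coeff (2 * n))" for n
  have *: "(\<lambda>n. a n * (z\<^sup>2) ^ n) sums cos z" for z
  proof -
    have "(\<lambda>n. cos_coeff (2 * n) *\<^sub>R z ^ (2 * n)) sums cos z"
      by (subst sums_mono_reindex[of "\<lambda>n. 2 * n" "\<lambda>n. cos_coeff n *\<^sub>R z ^ n"])
        (use cos_converges[of z] in \<open>auto simp: strict_mono_def cos_coeff_def elim!: evenE\<close>)
    then show ?thesis
      by (simp add: a_def scaleR_conv_of_real power_mult)
  qed
  define f where "f w = (\<Sum>n. a n * w ^ n)" for w
  have f: "f (z\<^sup>2) = cos z" for z
    using *[of z] by (simp add: f_def sums_iff)
  have "(\<lambda>n. a n * w ^ n) sums f w" for w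
    using *[of "csqrt w"] f[of "csqrt w"] by simp
  then have "f holomorphic_on UNIV"
    by (rule entire_if_power_series)
  with f show "\<exists>f. f holomorphic_on UNIV \<and> (\<forall>z. f (z\<^sup>2) = cos (z::complex))"
    by blast
next
  fix f g :: "complex \<Rightarrow> complex"
  assume "f holomorphic_on UNIV \<and> (\<forall>z. f (z\<^sup>2) = cos z)"
    and "g holomorphic_on UNIV \<and> (\<forall>z. g (z\<^sup>2) = cos z)"
  then have "f ((csqrt w)\<^sup>2) = g ((csqrt w)\<^sup>2)" for w
    by metis
  then show "f = g" by (simp add: fun_eq_iff)
qed

lemma ex1_entire_S:
  "\<exists>!f. f holomorphic_on UNIV \<and> (\<forall>z. z \<noteq> 0 \<longrightarrow> f (z\<^sup>2) = sin z / (z::complex))"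
proof (rule ex_ex1I)
  define a :: "nat \<Rightarrow> complex" where "a n = of_real (sin_coeff (2 * n + 1))" for n
  have *: "(\<lambda>n. a n * (z\<^sup>2) ^ n) sums (sin z / z)" if "z \<noteq> 0" for z
  proof -
    have "(\<lambda>n. sin_coeff (2 * n + 1) *\<^sub>R z ^ (2 * n + 1)) sums sin z"
      by (subst sums_mono_reindex[of "\<lambda>n. 2 * n + 1" "\<lambda>n. sin_coeff n *\<^sub>R z ^ n"])
        (use sin_converges[of z] in \<open>auto simp: strict_mono_def sin_coeff_def elim!: oddE\<close>)
    then have "(\<lambda>n. sin_coeff (2 * n + 1) *\<^sub>R z ^ (2 * n + 1) / z) sums (sin z / z)"
      by (rule sums_divide)
    then show ?thesis
      using that by (simp add: a_def scaleR_conv_of_real power_mult power_add)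
  qed
  define f where "f w = (\<Sum>n. a n * w ^ n)" for w
  have f: "f (z\<^sup>2) = sin z / z" if "z \<noteq> 0" for z
    using *[OF that] by (simp add: f_def sums_iff)
  have "(\<lambda>n. a n * w ^ n) sums f w" for w
  proof (cases "w = 0")
    case True
    then show ?thesis
      using powser_sums_zero[of a] by (simp add: f_def)
  next
    case False
    then show ?thesis
      using *[of "csqrt w"] f[of "csqrt w"] by simp
  qed
  then have "f holomorphic_on UNIV"
    by (rule entire_if_power_series)
  with f show "\<exists>f. f holomorphic_on UNIV \<and> (\<forall>z. z \<noteq> 0 \<longrightarrow> f (z\<^sup>2) = sin z / (z::complex))"
    by blast
next
  fix f g :: "complex \<Rightarrow> complex"
  assume f: "f holomorphic_on UNIV \<and> (\<forall>z. z \<noteq> 0 \<longrightarrow> f (z\<^sup>2) = sin z / z)"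
    and g: "g holomorphic_on UNIV \<and> (\<forall>z. z \<noteq> 0 \<longrightarrow> g (z\<^sup>2) = sin z / z)"
  have eq: "f w = g w" if "w \<noteq> 0" for w
  proof -
    have "csqrt w \<noteq> 0" using that by simp
    then have "f ((csqrt w)\<^sup>2) = g ((csqrt w)\<^sup>2)"
      using f g by metis
    then show ?thesis by simp
  qed
  have "(f \<longlongrightarrow> f 0) (at 0)" "(g \<longlongrightarrow> g 0) (at 0)"
    using f g holomorphic_on_imp_continuous_on[of _ UNIV]
    by (auto simp: continuous_on_def)
  moreover have "(g \<longlongrightarrow> f 0) (at 0) \<longleftrightarrow> (f \<longlongrightarrow> f 0) (at 0)"
    by (rule Lim_cong_within) (auto simp: eq)
  ultimately have "f 0 = g 0"
    using tendsto_unique[of "at (0::complex)" g "f 0" "g 0"] by simp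
  with eq show "f = g" by (metis ext)
qed

text \<open>
  The arguments of \<open>C\<close> and \<open>S\<close> below are real and both functions are real on the real axis
  (lemmas \<open>entire_C_of_real\<close> and \<open>entire_S_of_real\<close>), so \<^const>\<open>Re\<close> only changes the type.
\<close>
definition Exp :: "(nat \<Rightarrow> 'n::finite) \<Rightarrow> real ^ 'n \<Rightarrow> real ^ 'n \<Rightarrow> real ^ 'n" where
  "Exp ix p v = Re (entire_C (of_real (\<beta> ix v v))) *\<^sub>R p + Re (entire_S (of_real (\<beta> ix v v))) *\<^sub>R v"

lemma entire_C_holomorphic: "entire_C holomorphic_on UNIV"
  and entire_C_square: "entire_C (z\<^sup>2) = cos z"
  using theI'[OF ex1_entire_C] unfolding entire_C_def by blast+

lemma entire_S_holomorphic: "entire_S holomorphic_on UNIV"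
  and entire_S_square: "z \<noteq> 0 \<Longrightarrow> entire_S (z\<^sup>2) = sin z / z"
  using theI'[OF ex1_entire_S] unfolding entire_S_def by blast+

lemma entire_C_cnj: "entire_C (cnj w) = cnj (entire_C w)"
proof -
  have "cnj w = (cnj (csqrt w))\<^sup>2" by (simp flip: complex_cnj_power)
  then have "entire_C (cnj w) = cnj (cos (csqrt w))"
    by (simp add: entire_C_square cnj_cos)
  also have "cos (csqrt w) = entire_C w"
    using entire_C_square[of "csqrt w"] by simp
  finally show ?thesis .
qed

lemma entire_C_of_real: "entire_C (of_real r) \<in> \<real>"
  using entire_C_cnj[of "of_real r"] by (simp add: Reals_cnj_iff)

lemma entire_S_zero: "entire_S 0 = 1"
proof -
  have "((\<lambda>z. entire_S (z\<^sup>2)) \<longlongrightarrow> entire_S 0) (at 0)"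
  proof -
    have "continuous_on UNIV (\<lambda>z. entire_S (z\<^sup>2))"
      by (rule continuous_on_compose2[OF holomorphic_on_imp_continuous_on[OF entire_S_holomorphic]])
        (auto intro!: continuous_intros)
    then have "((\<lambda>z. entire_S (z\<^sup>2)) \<longlongrightarrow> entire_S (0\<^sup>2)) (at 0)"
      unfolding continuous_on_def by blast
    then show ?thesis by simp
  qed
  moreover have "((\<lambda>z. entire_S (z\<^sup>2)) \<longlongrightarrow> 1) (at 0)
      \<longleftrightarrow> ((\<lambda>z. sin z / z) \<longlongrightarrow> (1::complex)) (at 0)"
    by (rule Lim_cong_within) (auto simp: entire_S_square)
  moreover have "((\<lambda>z. sin z / z) \<longlongrightarrow> (1::complex)) (at 0)"
    using DERIV_sin[of "0::complex"] by (simp add: DERIV_def)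
  ultimately show ?thesis
    using tendsto_unique[of "at (0::complex)" "\<lambda>z. entire_S (z\<^sup>2)" "entire_S 0" 1] by simp
qed

lemma entire_S_of_real: "entire_S (of_real r) \<in> \<real>"
proof (cases "r = 0")
  case True
  then show ?thesis by (simp add: entire_S_zero)
next
  case False
  define w where "w = complex_of_real r"
  define s where "s = csqrt w"
  have s: "s \<noteq> 0" "s\<^sup>2 = w" "cnj w = w" using False by (auto simp: s_def w_def)
  have "entire_S ((cnj s)\<^sup>2) = cnj (entire_S (s\<^sup>2))"
    using s(1) by (simp add: entire_S_square cnj_sin)
  moreover have "(cnj s)\<^sup>2 = s\<^sup>2"
    using s(2,3) by (simp flip: complex_cnj_power)
  ultimately show ?thesis
    using s(2) by (simp add: w_def Reals_cnj_iff)
qed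


subsection \<open>The Euler element and the modular flow\<close>

definition euler_h :: "(nat \<Rightarrow> 'n::finite) \<Rightarrow> 'a::zero ^ 'n \<Rightarrow> 'a ^ 'n" where
  "euler_h ix x = (\<chi> j. if j = ix 1 then x $ ix 2 else if j = ix 2 then x $ ix 1 else 0)"

definition alpha :: "(nat \<Rightarrow> 'n::finite) \<Rightarrow> complex \<Rightarrow> complex ^ 'n \<Rightarrow> complex ^ 'n" where
  "alpha ix z x = (\<Sum>n. (z ^ n / fact n) *s ((euler_h ix ^^ n) x))"

definition tau_h :: "(nat \<Rightarrow> 'n::finite) \<Rightarrow> complex ^ 'n \<Rightarrow> complex ^ 'n" where
  "tau_h ix = alpha ix (of_real pi * \<i>)"

text \<open>
  \<open>\<tau>\<^sub>h\<close> is complex linear and preserves \<open>V\<close>, so precomposing it with the conjugation gives the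
  antilinear extension of its restriction to \<open>V\<close>.
\<close>
definition tau_bar :: "(nat \<Rightarrow> 'n::finite) \<Rightarrow> complex ^ 'n \<Rightarrow> complex ^ 'n" where
  "tau_bar ix z = tau_h ix (cnj_vec z)"

definition kappa_h :: "(nat \<Rightarrow> 'n::finite) \<Rightarrow> complex ^ 'n \<Rightarrow> complex ^ 'n" where
  "kappa_h ix = alpha ix (- (of_real pi * \<i>) / 2)"

definition fixed_points :: "(nat \<Rightarrow> 'n::finite) \<Rightarrow> (real ^ 'n) set" where
  "fixed_points ix =
     {x \<in> AdS ix. \<forall>t::real. alpha ix (of_real t) (complexify x) = complexify x}"

lemma sums_vecI:
  fixes f :: "nat \<Rightarrow> complex ^ 'n::finite"
  assumes "\<And>j. (\<lambda>n. f n $ j) sums (l $ j)"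
  shows "f sums l"
  using assms unfolding sums_def by (intro vec_tendstoI) simp

lemma alpha_eq:
  assumes "ix 1 \<noteq> ix 2"
  shows "alpha ix z x = (\<chi> j.
    if j = ix 1 then cosh z * x $ ix 1 + sinh z * x $ ix 2
    else if j = ix 2 then sinh z * x $ ix 1 + cosh z * x $ ix 2
    else x $ j)"
proof -
  let ?P = "\<lambda>n. (euler_h ix ^^ n) x"
  have pow: "?P n $ j = (if j = ix 1 then (if even n then x $ ix 1 else x $ ix 2)
     else if j = ix 2 then (if even n then x $ ix 2 else x $ ix 1)
     else if n = 0 then x $ j else 0)" for n j
    by (induction n arbitrary: j) (use assms in \<open>auto simp: euler_h_def\<close>)
  have c: "(\<lambda>n. if even n then z ^ n / fact n else 0) sums cosh z"
    using cosh_converges[of z] by (simp add: scaleR_conv_of_real field_simps cong: if_cong)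
  have s: "(\<lambda>n. if even n then 0 else z ^ n / fact n) sums sinh z"
    using sinh_converges[of z] by (simp add: scaleR_conv_of_real field_simps cong: if_cong)
  have cs: "(\<lambda>n. z ^ n / fact n * (if even n then u else v)) sums (cosh z * u + sinh z * v)"
    for u v :: complex
    by (rule sums_cong[THEN iffD1, OF _ sums_add[OF sums_mult2[OF c, of u] sums_mult2[OF s, of v]]])
      auto
  have one: "(\<lambda>n. z ^ n / fact n * (if n = 0 then u else 0)) sums u" for u :: complex
    using sums_single[of 0 "\<lambda>_. u"]
    by (rule sums_cong[THEN iffD1, rotated]) auto
  have "(\<lambda>n. (z ^ n / fact n) *s ?P n) sums (\<chi> j.
    if j = ix 1 then cosh z * x $ ix 1 + sinh z * x $ ix 2
    else if j = ix 2 then sinh z * x $ ix 1 + cosh z * x $ ix 2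
    else x $ j)"
  proof (rule sums_vecI)
    fix j
    show "(\<lambda>n. ((z ^ n / fact n) *s ?P n) $ j) sums ((\<chi> j.
      if j = ix 1 then cosh z * x $ ix 1 + sinh z * x $ ix 2
      else if j = ix 2 then sinh z * x $ ix 1 + cosh z * x $ ix 2
      else x $ j) $ j)"
      using cs[of "x $ ix 1" "x $ ix 2"] cs[of "x $ ix 2" "x $ ix 1"] one[of "x $ j"] assms
      by (simp add: pow add.commute)
  qed
  then show ?thesis
    by (simp add: alpha_def sums_iff)
qed

lemma tau_h_eq:
  assumes "ix 1 \<noteq> ix 2"
  shows "tau_h ix x = (\<chi> j. if j = ix 1 \<or> j = ix 2 then - x $ j else x $ j)"
proof -
  have "cosh (of_real pi * \<i>) = -1" "sinh (of_real pi * \<i>) = 0"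
    by (simp_all add: cosh_def sinh_def exp_minus scaleR_conv_of_real mult.commute[of _ \<i>])
  with assms show ?thesis
    by (simp add: tau_h_def alpha_eq vec_eq_iff)
qed

lemma kappa_h_eq:
  assumes "ix 1 \<noteq> ix 2"
  shows "kappa_h ix x = (\<chi> j. if j = ix 1 then - \<i> * x $ ix 2
     else if j = ix 2 then - \<i> * x $ ix 1 else x $ j)"
proof -
  have "exp (of_real pi * \<i> / 2) = \<i>"
    using cis_pi_half by (simp add: cis_conv_exp mult.commute)
  then have "cosh (- (of_real pi * \<i>) / 2) = 0" "sinh (- (of_real pi * \<i>) / 2) = - \<i>"
    by (simp_all add: cosh_def sinh_def exp_minus scaleR_conv_of_real)
  with assms show ?thesis
    by (simp add: kappa_h_def alpha_eq vec_eq_iff)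
qed


subsection \<open>The tube domain\<close>

definition AdS_complex :: "(nat \<Rightarrow> 'n::finite) \<Rightarrow> (complex ^ 'n) set" where
  "AdS_complex ix = {z. \<beta> ix z z = 1}"

definition normalize_beta :: "(nat \<Rightarrow> 'n::finite) \<Rightarrow> real ^ 'n \<Rightarrow> real ^ 'n" where
  "normalize_beta ix x = (1 / sqrt (\<beta> ix x x)) *\<^sub>R x"

definition tube :: "(nat \<Rightarrow> 'n::finite) \<Rightarrow> (complex ^ 'n) set" where
  "tube ix = {z \<in> AdS_complex ix. \<beta> ix (im_part z) (im_part z) > 0 \<and>
     im_part z \<in> Vplus ix (normalize_beta ix (re_part z))}"

definition tube_fixed :: "(nat \<Rightarrow> 'n::finite) \<Rightarrow> (complex ^ 'n) set" where
  "tube_fixed ix = {z \<in> tube ix. tau_bar ix z = z}"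


subsection \<open>The wedge domains\<close>

definition W_plus :: "(nat \<Rightarrow> 'n::finite) \<Rightarrow> (real ^ 'n) set" where
  "W_plus ix = {x \<in> AdS ix. euler_h ix x \<in> Vplus ix x}"

definition W_KMS :: "(nat \<Rightarrow> 'n::finite) \<Rightarrow> (real ^ 'n) set" where
  "W_KMS ix = {x \<in> AdS ix. \<forall>t\<in>{0<..<pi}. alpha ix (\<i> * of_real t) (complexify x) \<in> tube ix}"

definition tangent_eigen :: "(nat \<Rightarrow> 'n::finite) \<Rightarrow> real ^ 'n \<Rightarrow> real \<Rightarrow> (real ^ 'n) set" where
  "tangent_eigen ix m j = {v \<in> tangent ix m. euler_h ix v = j *\<^sub>R v}"

definition cone_c :: "(nat \<Rightarrow> 'n::finite) \<Rightarrow> real ^ 'n \<Rightarrow> (real ^ 'n) set" where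
  "cone_c ix m = {v - w |v w. v \<in> closure (Vplus ix m) \<inter> tangent_eigen ix m 1 \<and>
     w \<in> closure (Vplus ix m) \<inter> tangent_eigen ix m (- 1)}"

definition cone_c0 :: "(nat \<Rightarrow> 'n::finite) \<Rightarrow> real ^ 'n \<Rightarrow> (real ^ 'n) set" where
  "cone_c0 ix m =
     top_of_set {v + w |v w. v \<in> tangent_eigen ix m 1 \<and> w \<in> tangent_eigen ix m (- 1)}
       interior_of cone_c ix m"

definition W_M :: "(nat \<Rightarrow> 'n::finite) \<Rightarrow> (real ^ 'n) set" where
  "W_M ix = (\<Union>m\<in>fixed_points ix. Exp ix m ` cone_c0 ix m)"

end

theory Submission
  imports Defs
begin

text \<open>
  All four sets equal one explicit subset of AdS, called \<open>wedge\<close> below: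
  those \<open>x\<close> with \<open>x\<^sub>0 x\<^sub>2 > 0\<close> and \<open>x\<^sub>1\<^sup>2 < x\<^sub>2\<^sup>2\<close>.

  The key is to replace the group-theoretic causal structure by inequalities. For \<open>p\<close> in AdS, a
  tangent vector \<open>v\<close> with \<open>\<beta>(v, v) > 0\<close> spans with \<open>p\<close> a positive definite plane. The projection
  of such a plane to the first two coordinates is injective, so the determinant
  \<open>p\<^sub>0 v\<^sub>1 - p\<^sub>1 v\<^sub>0\<close> does not vanish, and its sign cannot change along the connected group \<open>G\<close>.
  Since \<open>G\<close> is transitive on AdS, the cone at \<open>p\<close> consists exactly of the tangent vectors with
  \<open>\<beta>(v, v) > 0\<close> for which this sign is positive (\<open>Vplus_iff\<close>). Transitivity follows from
  products of two reflections, which can be deformed to the identity. The tube domain is thereby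
  cut out by two inequalities as well (\<open>tube_iff\<close>).

  What remains is computation. The vector \<open>hx\<close> satisfies \<open>\<beta>(hx, hx) = x\<^sub>2\<^sup>2 - x\<^sub>1\<^sup>2\<close> and has determinant
  \<open>x\<^sub>0 x\<^sub>2\<close> with \<open>x\<close>, which gives the positivity domain. The imaginary part of \<open>\<alpha>\<^sub>i\<^sub>t(x)\<close> is
  \<open>sin t \<cdot> hx\<close>, so for every single \<open>t\<close> strictly between \<open>0\<close> and \<open>\<pi>\<close> the point \<open>\<alpha>\<^sub>i\<^sub>t(x)\<close> lies
  in the tube iff \<open>x\<close> lies in the wedge (\<open>alpha_in_tube_iff\<close>). This settles the KMS domain, and,
  at \<open>t = \<pi>/2\<close>, also the tube domain, because \<open>\<kappa>\<^sub>h\<close> inverts \<open>\<alpha>\<^sub>i\<^sub>t\<close> for this \<open>t\<close> and turns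
  the fixed points of the antilinear involution into the real points. Finally the cone at a fixed
  point \<open>m\<close> of the flow consists of the vectors \<open>a e\<^sub>1 + b e\<^sub>2\<close> with \<open>m\<^sub>0 b > 0\<close> and
  \<open>a\<^sup>2 < b\<^sup>2\<close> (\<open>cone_c0_eq\<close>, \<open>strict_cone_iff\<close>); on such vectors the exponential map is a
  hyperbolic geodesic, and its hyperbolic polar coordinates sweep out the wedge.
\<close>

(* The dollar sign is reserved for vector components, and the coordinate index 1 is kept from
   being rewritten to Suc 0. *)
no_notation fps_nth (infixl "$" 75)
declare One_nat_def [simp del]

section \<open>The bilinear form\<close>

lemma beta_commute: "\<beta> ix x y = \<beta> ix y x"
  by (simp add: \<beta>_def mult.commute)

lemma beta_add_left: "\<beta> ix (x + y) z = \<beta> ix x z + \<beta> ix y z"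
  by (simp add: \<beta>_def algebra_simps sum.distrib)

lemma beta_diff_left: "\<beta> ix (x - y) z = \<beta> ix x z - \<beta> ix y z"
  by (simp add: \<beta>_def algebra_simps sum_subtractf)

lemma beta_scaleR_left:
  fixes x :: "real ^ 'n::finite"
  shows "\<beta> ix (c *\<^sub>R x) z = c * \<beta> ix x z"
  by (simp add: \<beta>_def algebra_simps sum_distrib_left)

lemma beta_add_right: "\<beta> ix z (x + y) = \<beta> ix z x + \<beta> ix z y"
  by (metis beta_add_left beta_commute)

lemma beta_diff_right: "\<beta> ix z (x - y) = \<beta> ix z x - \<beta> ix z y"
  by (metis beta_diff_left beta_commute)

lemma beta_scaleR_right:
  fixes x :: "real ^ 'n::finite"
  shows "\<beta> ix z (c *\<^sub>R x) = c * \<beta> ix z x"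
  by (metis beta_scaleR_left beta_commute)

lemmas beta_bilinear = beta_add_left beta_add_right beta_diff_left beta_diff_right
  beta_scaleR_left beta_scaleR_right

lemma beta_axis:
  assumes "ix 0 \<noteq> ix 1"
  shows "\<beta> ix (axis (ix 0) 1) x = (x $ ix 0 :: 'a::comm_ring_1)"
    and "\<beta> ix (axis (ix 1) 1) x = x $ ix 1"
  using assms by (auto simp: \<beta>_def axis_def intro!: sum.neutral)

text \<open>
  Positive directions are visible in the first two coordinates: this makes the projection of a
  positive definite plane to these coordinates injective.
\<close>
lemma beta_nonpos:
  fixes w :: "real ^ 'n::finite"
  assumes "w $ ix 0 = 0" "w $ ix 1 = 0"
  shows "\<beta> ix w w \<le> 0"
  using assms by (simp add: \<beta>_def sum_nonneg)

lemma beta_complex_self: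
  "\<beta> ix z z = Complex (\<beta> ix (re_part z) (re_part z) - \<beta> ix (im_part z) (im_part z))
    (2 * \<beta> ix (re_part z) (im_part z))"
  by (simp add: \<beta>_def re_part_def im_part_def complex_eq_iff sum_subtractf sum.distrib
    sum_distrib_left algebra_simps)

text \<open>
  The determinant of the projections of \<open>p\<close> and \<open>v\<close> to the two positive coordinates. On positive
  definite planes its sign is the time orientation.
\<close>
definition orient :: "(nat \<Rightarrow> 'n::finite) \<Rightarrow> real ^ 'n \<Rightarrow> real ^ 'n \<Rightarrow> real" where
  "orient ix p v = p $ ix 0 * v $ ix 1 - p $ ix 1 * v $ ix 0"

text \<open>
  If the determinant vanished, a nontrivial combination of \<open>p\<close> and \<open>v\<close> would have its first two
  coordinates equal to \<open>0\<close>, contradicting positive definiteness of the plane they span.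
\<close>
lemma orient_nonzero:
  assumes "\<beta> ix p v = 0" "\<beta> ix p p > 0" "\<beta> ix v v > 0"
  shows "orient ix p v \<noteq> 0"
proof
  assume 0: "orient ix p v = 0"
  \<comment> \<open>Used for the combinations that eliminate one coordinate; a vanishing determinant makes the
    other coordinate vanish too.\<close>
  have *: "a = 0 \<and> b = 0" if "w = a *\<^sub>R p - b *\<^sub>R v" "w $ ix 0 = 0" "w $ ix 1 = 0" for a b w
  proof -
    have "\<beta> ix w w = a\<^sup>2 * \<beta> ix p p + b\<^sup>2 * \<beta> ix v v"
      using assms(1) beta_commute[of ix v p]
      by (simp add: that(1) beta_bilinear power2_eq_square algebra_simps)
    with beta_nonpos[of w ix] that have le: "a\<^sup>2 * \<beta> ix p p + b\<^sup>2 * \<beta> ix v v \<le> 0" by simp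
    have "a\<^sup>2 * \<beta> ix p p \<ge> 0" "b\<^sup>2 * \<beta> ix v v \<ge> 0" using assms by simp_all
    with le have "a\<^sup>2 * \<beta> ix p p = 0" "b\<^sup>2 * \<beta> ix v v = 0" by linarith+
    then show ?thesis using assms by simp
  qed
  have "p $ ix 1 = 0"
    using 0 *[of "v $ ix 1 *\<^sub>R p - p $ ix 1 *\<^sub>R v" "v $ ix 1" "p $ ix 1"]
    by (simp add: orient_def algebra_simps)
  moreover have "p $ ix 0 = 0"
    using 0 *[of "v $ ix 0 *\<^sub>R p - p $ ix 0 *\<^sub>R v" "v $ ix 0" "p $ ix 0"]
    by (simp add: orient_def algebra_simps)
  ultimately show False using beta_nonpos[of p ix] assms by simp
qed


section \<open>Transitivity of the identity component on AdS\<close>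

text \<open>
  The orthogonal reflection in the hyperplane \<open>a\<^sup>\<bottom>\<close> with respect to \<open>\<beta>\<close>. It is given as a matrix
  because the group is a topological space of matrices.
\<close>
definition reflection :: "(nat \<Rightarrow> 'n::finite) \<Rightarrow> real ^ 'n \<Rightarrow> real ^ 'n ^ 'n" where
  "reflection ix a = (\<chi> i j. (if i = j then 1 else 0)
     - 2 * a $ i * (if j \<in> {ix 0, ix 1} then a $ j else - a $ j) / \<beta> ix a a)"

lemma reflection_apply:
  assumes "ix 0 \<noteq> ix 1"
  shows "reflection ix a *v x = x - (2 * \<beta> ix a x / \<beta> ix a a) *\<^sub>R a"
proof -
  have b: "\<beta> ix a x = (\<Sum>j\<in>UNIV. (if j \<in> {ix 0, ix 1} then a $ j else - a $ j) * x $ j)"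
  proof -
    have "(\<Sum>j\<in>UNIV. (if j \<in> {ix 0, ix 1} then a $ j else - a $ j) * x $ j)
      = (\<Sum>j\<in>{ix 0, ix 1}. a $ j * x $ j) + (\<Sum>j\<in>UNIV - {ix 0, ix 1}. - (a $ j * x $ j))"
      by (subst sum.subset_diff[of "{ix 0, ix 1}" UNIV]) (simp_all add: add.commute)
    then show ?thesis using assms by (simp add: \<beta>_def sum_negf)
  qed
  have "(reflection ix a *v x) $ i = (x - (2 * \<beta> ix a x / \<beta> ix a a) *\<^sub>R a) $ i" for i
  proof -
    define e where "e j = (if j \<in> {ix 0, ix 1} then a $ j else - a $ j)" for j
    have "(reflection ix a *v x) $ i
      = (\<Sum>j\<in>UNIV. (if i = j then x $ j else 0) - 2 * a $ i / \<beta> ix a a * (e j * x $ j))"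
      unfolding matrix_vector_mult_def reflection_def e_def[symmetric]
      by (auto simp: algebra_simps intro!: sum.cong)
    also have "\<dots> = x $ i - 2 * a $ i / \<beta> ix a a * \<beta> ix a x"
      by (simp add: sum_subtractf b e_def sum_distrib_left)
    finally show ?thesis by simp
  qed
  then show ?thesis by (simp add: vec_eq_iff)
qed

lemma beta_reflection:
  assumes "ix 0 \<noteq> ix 1" "\<beta> ix a a \<noteq> 0"
  shows "\<beta> ix (reflection ix a *v x) (reflection ix a *v y) = \<beta> ix x y"
  using assms(2) beta_commute[of ix x a] beta_commute[of ix y a]
  by (simp add: reflection_apply[OF assms(1)] beta_bilinear field_simps)

lemma reflection_involution:
  assumes "ix 0 \<noteq> ix 1" "\<beta> ix a a \<noteq> 0"
  shows "reflection ix a ** reflection ix a = mat 1"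
  unfolding matrix_eq using assms
  by (simp add: reflection_apply beta_bilinear vec_eq_iff field_simps flip: matrix_vector_mul_assoc)

lemma continuous_on_beta [continuous_intros]:
  fixes f g :: "'a::topological_space \<Rightarrow> real ^ 'n::finite"
  assumes "continuous_on S f" "continuous_on S g"
  shows "continuous_on S (\<lambda>t. \<beta> ix (f t) (g t))"
  unfolding \<beta>_def by (intro continuous_intros assms)

lemma continuous_on_matrix_vector_mult [continuous_intros]:
  fixes A :: "'a::topological_space \<Rightarrow> real ^ 'n::finite ^ 'm::finite"
  assumes "continuous_on S A" "continuous_on S f"
  shows "continuous_on S (\<lambda>t. A t *v f t)"
  unfolding matrix_vector_mult_def by (intro continuous_intros continuous_on_vec_lambda assms)

lemma continuous_on_matrix_mult [continuous_intros]:
  fixes A :: "'a::topological_space \<Rightarrow> real ^ 'n::finite ^ 'm::finite"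
    and B :: "'a::topological_space \<Rightarrow> real ^ 'k::finite ^ 'n"
  assumes "continuous_on S A" "continuous_on S B"
  shows "continuous_on S (\<lambda>t. A t ** B t)"
  unfolding matrix_matrix_mult_def by (intro continuous_intros continuous_on_vec_lambda assms)

lemma continuous_on_reflection [continuous_intros]:
  assumes "continuous_on S f" "\<And>t. t \<in> S \<Longrightarrow> \<beta> ix (f t) (f t) \<noteq> 0"
  shows "continuous_on S (\<lambda>t. reflection ix (f t))"
proof -
  have "continuous_on S (\<lambda>t. if j \<in> {ix 0, ix 1} then f t $ j else - f t $ j)" for j
    by (cases "j \<in> {ix 0, ix 1}") (simp_all only: if_True if_False, (intro continuous_intros assms)+)
  then show ?thesis
    unfolding reflection_def using assms(2)
    by (intro continuous_intros continuous_on_vec_lambda assms) auto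
qed

lemma continuous_on_det [continuous_intros]:
  fixes A :: "'a::topological_space \<Rightarrow> real ^ 'n::finite ^ 'n"
  assumes "continuous_on S A"
  shows "continuous_on S (\<lambda>t. det (A t))"
  unfolding det_def by (intro continuous_intros assms)

lemma connected_nonzero_pos:
  fixes f :: "'a::topological_space \<Rightarrow> real"
  assumes "connected T" "continuous_on T f" "\<And>t. t \<in> T \<Longrightarrow> f t \<noteq> 0" "a \<in> T" "f a > 0" "b \<in> T"
  shows "f b > 0"
proof (rule ccontr)
  assume "\<not> f b > 0"
  then have "f b \<le> 0" "0 \<le> f a" using assms by auto
  moreover have "connected (f ` T)" using assms by (intro connected_continuous_image)
  ultimately have "0 \<in> f ` T"
    using connectedD_interval[of "f ` T" "f b" "f a" 0] assms by auto
  then show False using assms(3) by auto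
qed

lemma SO_group_G_group: "g \<in> G_group ix \<Longrightarrow> g \<in> SO_group ix"
  unfolding G_group_def using connected_component_subset by blast

lemma G_group_mult:
  assumes "g \<in> G_group ix" "k \<in> G_group ix"
  shows "g ** k \<in> G_group ix"
proof -
  let ?S = "SO_group ix"
  have g: "g \<in> ?S" using assms(1) by (rule SO_group_G_group)
  obtain T where T: "connected T" "T \<subseteq> ?S" "mat 1 \<in> T" "k \<in> T"
    using assms(2) by (auto simp: G_group_def connected_component_def)
  have "connected ((**) g ` T)"
    using T(1) by (intro connected_continuous_image continuous_intros)
  moreover have "(**) g ` T \<subseteq> ?S"
    using g T(2) by (auto simp: SO_group_def det_mul simp flip: matrix_vector_mul_assoc)
  moreover have "g \<in> (**) g ` T" using T(3) by (auto intro: image_eqI[of _ _ "mat 1"])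
  moreover have "g ** k \<in> (**) g ` T" using T(4) by blast
  ultimately have "connected_component ?S g (g ** k)"
    unfolding connected_component_def by blast
  then show ?thesis
    using assms(1) unfolding G_group_def by (auto intro: connected_component_trans)
qed

text \<open>
  With \<open>s\<^sub>a\<close> the reflection in \<open>a\<^sup>\<bottom>\<close>, the product \<open>s\<^bsub>x+y\<^esub> s\<^sub>x\<close> takes \<open>x\<close> to \<open>- x\<close> and then to
  \<open>y\<close>. The hypothesis keeps \<open>x + t y\<close> positive for \<open>0 \<le> t \<le> 1\<close>, so \<open>s\<^bsub>x+ty\<^esub> s\<^sub>x\<close> is a path
  of isometries from the identity to this product. Its determinant is \<open>\<plusminus>1\<close>, reflections being
  involutions, hence constantly \<open>1\<close> by continuity.
\<close>
lemma G_group_reflection_pair: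
  assumes ne: "ix 0 \<noteq> ix 1" and x: "\<beta> ix x x = 1" and y: "\<beta> ix y y = 1" and xy: "\<beta> ix x y > -1"
  shows "\<exists>g\<in>G_group ix. g *v x = y"
proof -
  let ?c = "\<lambda>t. x + t *\<^sub>R y"
  let ?g = "\<lambda>t. reflection ix (?c t) ** reflection ix x"
  have pos: "\<beta> ix (?c t) (?c t) > 0" if "t \<in> {0..1}" for t
  proof -
    have "\<beta> ix (?c t) (?c t) = (1 - t)\<^sup>2 + 2 * t * (1 + \<beta> ix x y)"
      using x y beta_commute[of ix y x]
      by (simp add: beta_bilinear power2_eq_square algebra_simps)
    moreover have "(1 - t)\<^sup>2 > 0 \<or> 2 * t * (1 + \<beta> ix x y) > 0"
      using that xy by (cases "t = 1") auto
    moreover have "(1 - t)\<^sup>2 \<ge> 0" "2 * t * (1 + \<beta> ix x y) \<ge> 0" using that xy by simp_all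
    ultimately show ?thesis by linarith
  qed
  have cont: "continuous_on {0..1} ?g"
  proof (intro continuous_intros)
    show "\<beta> ix (?c t) (?c t) \<noteq> 0" if "t \<in> {0..1}" for t using pos[OF that] by simp
  qed
  have g0: "?g 0 = mat 1" using reflection_involution[OF ne, of x] x by simp
  have det_sq: "(det (?g t))\<^sup>2 = 1" if "t \<in> {0..1}" for t
  proof -
    have "(det (reflection ix a))\<^sup>2 = 1" if "\<beta> ix a a > 0" for a
      using arg_cong[OF reflection_involution[OF ne, of a], of det] that
      by (simp add: det_mul power2_eq_square)
    then show ?thesis using pos[OF that] x by (simp add: det_mul power_mult_distrib)
  qed
  have "det (?g t) > 0" if "t \<in> {0..1}" for t
  proof (rule connected_nonzero_pos[of "{0..1}" "\<lambda>t. det (?g t)" 0])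
    show "continuous_on {0..1} (\<lambda>t. det (?g t))" by (intro continuous_on_det cont)
    show "det (?g s) \<noteq> 0" if "s \<in> {0..1}" for s using det_sq[OF that] by auto
    show "0 < det (?g 0)" unfolding g0 by simp
  qed (use that in simp_all)
  then have det: "det (?g t) = 1" if "t \<in> {0..1}" for t
    using det_sq[OF that] that by (fastforce simp: power2_eq_1_iff)
  have "?g ` {0..1} \<subseteq> SO_group ix"
  proof (rule image_subsetI)
    fix t :: real assume t: "t \<in> {0..1}"
    then show "?g t \<in> SO_group ix"
      using pos[OF t] x beta_reflection[OF ne] det[OF t]
      by (simp add: SO_group_def flip: matrix_vector_mul_assoc)
  qed
  moreover have "connected (?g ` {0..1})" using cont by (intro connected_continuous_image) auto
  moreover have "mat 1 \<in> ?g ` {0..1}" by (rule image_eqI[of _ _ 0]) (use g0 in simp_all)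
  moreover have "?g 1 \<in> ?g ` {0..1}" by (rule imageI) simp
  ultimately have "?g 1 \<in> G_group ix"
    unfolding G_group_def connected_component_def by blast
  moreover have "?g 1 *v x = y"
  proof -
    have refl: "reflection ix x *v x = - x" using x by (simp add: reflection_apply[OF ne] vec_eq_iff)
    have "2 * \<beta> ix (x + y) (- x) / \<beta> ix (x + y) (x + y) = -1"
    proof -
      have "\<beta> ix (x + y) (- x) = - (1 + \<beta> ix x y)"
        using x beta_commute[of ix y x] beta_scaleR_right[of ix "x + y" "-1" x]
        by (simp add: beta_bilinear)
      moreover have "\<beta> ix (x + y) (x + y) = 2 * (1 + \<beta> ix x y)"
        using x y beta_commute[of ix y x] by (simp add: beta_bilinear)
      ultimately show ?thesis using xy by (simp add: field_simps)
    qed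
    then have "reflection ix (x + y) *v (reflection ix x *v x) = y"
      unfolding refl by (simp only: reflection_apply[OF ne]) simp
    then show ?thesis by (simp add: matrix_vector_mul_assoc)
  qed
  ultimately show ?thesis by blast
qed

text \<open>
  The base point \<open>e\<^sub>0\<close> may be too far from \<open>p\<close> for a single pair of reflections (when
  \<open>p\<^sub>0 \<le> -1\<close>), so the way leads through \<open>e\<^sub>1\<close> or \<open>- e\<^sub>1\<close>: both are orthogonal to \<open>e\<^sub>0\<close>, and one
  of them has nonnegative product with \<open>p\<close>.
\<close>
lemma G_group_transitive:
  assumes ne: "ix 0 \<noteq> ix 1" and p: "p \<in> AdS ix"
  shows "\<exists>g\<in>G_group ix. g *v axis (ix 0) 1 = p"
proof -
  define s :: real where "s = (if p $ ix 1 \<ge> 0 then 1 else -1)"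
  define q :: "real ^ 'a" where "q = s *\<^sub>R axis (ix 1) 1"
  have "s * s = 1" "s * p $ ix 1 \<ge> 0" by (simp_all add: s_def)
  then have q: "\<beta> ix q q = 1" "\<beta> ix (axis (ix 0) 1) q > -1" "\<beta> ix q p > -1"
    using ne by (simp_all add: q_def beta_scaleR_left beta_axis beta_scaleR_right) (auto simp: axis_def)
  obtain g where g: "g \<in> G_group ix" "g *v axis (ix 0) 1 = q"
    using G_group_reflection_pair[OF ne _ q(1,2)] by (auto simp: beta_axis[OF ne])
  obtain k where k: "k \<in> G_group ix" "k *v q = p"
    using G_group_reflection_pair[OF ne q(1) _ q(3)] p by (auto simp: AdS_def)
  have "(k ** g) *v axis (ix 0) 1 = p" using g k by (simp flip: matrix_vector_mul_assoc)
  with G_group_mult[OF k(1) g(1)] show ?thesis by blast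
qed


section \<open>The causal structure in coordinates\<close>

text \<open>
  Along a connected set of isometries from the identity to \<open>g\<close> the determinant never vanishes, so
  it keeps the positive sign that it has at the identity.
\<close>
lemma orient_G_group_pos:
  assumes ne: "ix 0 \<noteq> ix 1" and g: "g \<in> G_group ix" and w: "w \<in> Vplus_base ix"
  shows "orient ix (g *v axis (ix 0) 1) (g *v w) > 0"
proof -
  let ?e = "axis (ix 0) 1 :: real ^ 'a"
  obtain T where T: "connected T" "T \<subseteq> SO_group ix" "mat 1 \<in> T" "g \<in> T"
    using g by (auto simp: G_group_def connected_component_def)
  have w': "\<beta> ix ?e w = 0" "\<beta> ix w w > 0" "w $ ix 1 > 0"
    using w ne by (auto simp: Vplus_base_def tangent_def beta_axis beta_commute[of ix w "axis _ _"])
  show ?thesis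
  proof (rule connected_nonzero_pos[OF T(1) _ _ T(3) _ T(4)])
    show "continuous_on T (\<lambda>g. orient ix (g *v ?e) (g *v w))"
      unfolding orient_def by (intro continuous_intros)
    show "orient ix (k *v ?e) (k *v w) \<noteq> 0" if "k \<in> T" for k
      using that T(2) w' by (intro orient_nonzero) (auto simp: SO_group_def beta_axis[OF ne])
    show "0 < orient ix (mat 1 *v ?e) (mat 1 *v w)"
      using w' ne by (auto simp: orient_def axis_def)
  qed
qed

text \<open>
  The cone field without the group. Conversely to the previous lemma, a vector \<open>v\<close> with these
  properties is moved back to the base point by some \<open>g\<close>; there it lies in the base cone or in its
  negative, and the sign of the determinant excludes the latter.
\<close>
theorem Vplus_iff:
  assumes ne: "ix 0 \<noteq> ix 1" and p: "p \<in> AdS ix"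
  shows "v \<in> Vplus ix p \<longleftrightarrow> \<beta> ix p v = 0 \<and> \<beta> ix v v > 0 \<and> orient ix p v > 0"
proof
  assume "v \<in> Vplus ix p"
  then obtain g w where g: "g \<in> G_group ix" "g *v axis (ix 0) 1 = p"
    and w: "w \<in> Vplus_base ix" and v: "v = g *v w"
    by (auto simp: Vplus_def)
  have "\<beta> ix (g *v x) (g *v y) = \<beta> ix x y" for x y
    using SO_group_G_group[OF g(1)] by (simp add: SO_group_def)
  with g(2) v w orient_G_group_pos[OF ne g(1) w]
  show "\<beta> ix p v = 0 \<and> \<beta> ix v v > 0 \<and> orient ix p v > 0"
    by (auto simp: Vplus_base_def tangent_def)
next
  assume v: "\<beta> ix p v = 0 \<and> \<beta> ix v v > 0 \<and> orient ix p v > 0"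
  obtain g where g: "g \<in> G_group ix" "g *v axis (ix 0) 1 = p"
    using G_group_transitive[OF ne p] by blast
  have inv: "\<beta> ix (g *v x) (g *v y) = \<beta> ix x y" for x y
    using SO_group_G_group[OF g(1)] by (simp add: SO_group_def)
  have "det g \<noteq> 0" using SO_group_G_group[OF g(1)] by (simp add: SO_group_def)
  then have "invertible g" by (simp add: invertible_det_nz)
  then obtain k where "g ** k = mat 1" by (auto simp: invertible_def)
  then have gw: "g *v (k *v v) = v" by (simp add: matrix_vector_mul_assoc)
  define w where "w = k *v v"
  have w: "w $ ix 0 = 0" "\<beta> ix w w > 0"
    using inv[of "axis (ix 0) 1" w] inv[of w w] g v gw by (simp_all add: w_def beta_axis[OF ne])
  have "w $ ix 1 \<noteq> 0" using w beta_nonpos[of w ix] by auto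
  moreover have False if "w $ ix 1 < 0"
  proof -
    have "- w \<in> Vplus_base ix"
      using w that beta_scaleR_left[of ix "-1"] beta_scaleR_right[of ix _ "-1"]
      by (simp add: Vplus_base_def tangent_def beta_axis[OF ne] beta_commute[of ix w "axis _ _"])
    from orient_G_group_pos[OF ne g(1) this] g(2) gw v show False
      by (simp add: orient_def w_def linear_neg)
  qed
  ultimately have "w \<in> Vplus_base ix"
    using w by (force simp: Vplus_base_def tangent_def beta_axis[OF ne] beta_commute[of ix w "axis _ _"])
  with g gw show "v \<in> Vplus ix p" unfolding Vplus_def w_def by force
qed

text \<open>
  Normalizing the real part is a scaling by a positive factor, which neither changes the sign of
  the determinant nor orthogonality; orthogonality itself is the imaginary part of
  \<open>\<beta>(z, z) = 1\<close>.
\<close>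
lemma tube_iff:
  assumes ne: "ix 0 \<noteq> ix 1"
  shows "z \<in> tube ix \<longleftrightarrow> \<beta> ix z z = 1 \<and> \<beta> ix (im_part z) (im_part z) > 0
    \<and> orient ix (re_part z) (im_part z) > 0"
proof -
  let ?x = "re_part z" and ?y = "im_part z"
  have "orient ix ?x ?y > 0 \<longleftrightarrow> ?y \<in> Vplus ix (normalize_beta ix ?x)"
    if z: "\<beta> ix z z = 1" and y: "\<beta> ix ?y ?y > 0"
  proof -
    have xy: "\<beta> ix ?x ?x = 1 + \<beta> ix ?y ?y" "\<beta> ix ?x ?y = 0"
      using z unfolding beta_complex_self by (simp_all add: complex_eq_iff)
    define c where "c = 1 / sqrt (\<beta> ix ?x ?x)"
    have c: "c > 0" "c * (c * \<beta> ix ?x ?x) = 1"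
      using xy y by (simp_all add: c_def)
    have n: "normalize_beta ix ?x = c *\<^sub>R ?x"
      by (simp add: normalize_beta_def c_def)
    have "c *\<^sub>R ?x \<in> AdS ix"
      using c(2) by (simp add: AdS_def beta_scaleR_left beta_scaleR_right)
    moreover have "orient ix (c *\<^sub>R ?x) ?y = c * orient ix ?x ?y"
      by (simp add: orient_def algebra_simps)
    ultimately show ?thesis
      using c(1) xy(2) y
      by (simp add: n Vplus_iff[OF ne] beta_scaleR_left zero_less_mult_iff)
  qed
  then show ?thesis by (auto simp: tube_def AdS_complex_def)
qed


section \<open>The wedge in coordinates\<close>

definition wedge :: "(nat \<Rightarrow> 'n::finite) \<Rightarrow> (real ^ 'n) set" where
  "wedge ix = {x \<in> AdS ix. x $ ix 0 * x $ ix 2 > 0 \<and> (x $ ix 1)\<^sup>2 < (x $ ix 2)\<^sup>2}"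

lemma beta_split:
  assumes "distinct [ix 0, ix 1, ix 2]"
  shows "\<beta> ix x y = x $ ix 0 * y $ ix 0 + x $ ix 1 * y $ ix 1 - x $ ix 2 * y $ ix 2
    - (\<Sum>j\<in>UNIV - {ix 0, ix 1, ix 2}. x $ j * y $ j)"
proof -
  have "UNIV - {ix 0, ix 1} = insert (ix 2) (UNIV - {ix 0, ix 1, ix 2})"
    using assms by auto
  then show ?thesis by (simp add: \<beta>_def algebra_simps)
qed

lemma beta_euler_h:
  fixes x :: "real ^ 'n::finite"
  assumes "distinct [ix 0, ix 1, ix 2]"
  shows "\<beta> ix x (euler_h ix x) = 0"
    and "\<beta> ix (euler_h ix x) (euler_h ix x) = (x $ ix 2)\<^sup>2 - (x $ ix 1)\<^sup>2"
    and "orient ix x (euler_h ix x) = x $ ix 0 * x $ ix 2"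
  using assms unfolding beta_split[OF assms]
  by (auto simp: euler_h_def orient_def power2_eq_square)

lemma W_plus_eq_wedge:
  assumes "distinct [ix 0, ix 1, ix 2]"
  shows "W_plus ix = wedge ix"
  using assms by (auto simp: W_plus_def wedge_def Vplus_iff beta_euler_h)

lemma beta_alpha:
  assumes "distinct [ix 0, ix 1, ix 2]"
  shows "\<beta> ix (alpha ix z x) (alpha ix z x) = \<beta> ix x x"
proof -
  have h: "cosh z * cosh z = 1 + sinh z * sinh z"
    using hyperbolic_pythagoras[of z] by (simp add: power2_eq_square algebra_simps)
  have "(cosh z * a + sinh z * b) * (cosh z * a + sinh z * b)
      - (sinh z * a + cosh z * b) * (sinh z * a + cosh z * b) = a * a - b * b" for a b
    using h by algebra
  then have h': "(cosh z * a + sinh z * b) * (cosh z * a + sinh z * b)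
      = a * a - b * b + (sinh z * a + cosh z * b) * (sinh z * a + cosh z * b)" for a b
    by (simp add: algebra_simps)
  show ?thesis
    unfolding beta_split[OF assms] using assms by (simp add: alpha_eq h')
qed

lemma beta_complexify: "\<beta> ix (complexify x) (complexify y) = of_real (\<beta> ix x y)"
  by (simp add: \<beta>_def complexify_def)

lemma cosh_imaginary: "cosh (\<i> * of_real t) = complex_of_real (cos t)"
  and sinh_imaginary: "sinh (\<i> * of_real t) = \<i> * complex_of_real (sin t)"
  by (simp_all add: cosh_def sinh_def exp_Euler exp_minus_Euler cos_of_real sin_of_real scaleR_conv_of_real)

lemma alpha_imaginary_parts:
  assumes "ix 1 \<noteq> ix 2"
  shows "re_part (alpha ix (\<i> * of_real t) (complexify x))
      = (\<chi> j. if j \<in> {ix 1, ix 2} then cos t * x $ j else x $ j)"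
    and "im_part (alpha ix (\<i> * of_real t) (complexify x)) = sin t *\<^sub>R euler_h ix x"
proof -
  show "re_part (alpha ix (\<i> * of_real t) (complexify x))
      = (\<chi> j. if j \<in> {ix 1, ix 2} then cos t * x $ j else x $ j)"
    and "im_part (alpha ix (\<i> * of_real t) (complexify x)) = sin t *\<^sub>R euler_h ix x"
    using assms
    by (auto simp: vec_eq_iff re_part_def im_part_def alpha_eq complexify_def cosh_imaginary sinh_imaginary euler_h_def)
qed

text \<open>
  The parameter \<open>t\<close> enters only through the positive factors \<open>(sin t)\<^sup>2\<close> and \<open>sin t\<close>: in the
  determinant with the imaginary part \<open>sin t \<cdot> hx\<close>, whose \<open>e\<^sub>0\<close>-coordinate is \<open>0\<close>, the coordinate
  \<open>cos t \<cdot> x\<^sub>1\<close> of the real part drops out.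
\<close>
lemma alpha_in_tube_iff:
  assumes dist: "distinct [ix 0, ix 1, ix 2]" and t: "t \<in> {0<..<pi}"
  shows "alpha ix (\<i> * of_real t) (complexify x) \<in> tube ix \<longleftrightarrow> x \<in> wedge ix"
proof -
  let ?z = "alpha ix (\<i> * of_real t) (complexify x)"
  have s: "sin t > 0" using t by (simp add: sin_gt_zero)
  have 1: "\<beta> ix ?z ?z = 1 \<longleftrightarrow> x \<in> AdS ix"
    by (simp only: beta_alpha[OF dist] beta_complexify AdS_def mem_Collect_eq of_real_eq_1_iff)
  have 2: "\<beta> ix (im_part ?z) (im_part ?z) = sin t * sin t * ((x $ ix 2)\<^sup>2 - (x $ ix 1)\<^sup>2)"
    using dist by (simp add: alpha_imaginary_parts beta_scaleR_left beta_scaleR_right beta_euler_h)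
  have 3: "orient ix (re_part ?z) (im_part ?z) = sin t * (x $ ix 0 * x $ ix 2)"
    using dist by (auto simp: alpha_imaginary_parts orient_def euler_h_def)
  have "ix 0 \<noteq> ix 1" using dist by simp
  from tube_iff[OF this, of ?z] show ?thesis
    unfolding 1 2 3 wedge_def using s by (auto simp: zero_less_mult_iff)
qed

lemma W_KMS_eq_wedge:
  assumes "distinct [ix 0, ix 1, ix 2]"
  shows "W_KMS ix = wedge ix"
proof -
  have "\<exists>t. t \<in> {0<..<pi}" using pi_gt_zero by (intro exI[of _ "pi / 2"]) simp
  moreover have "wedge ix \<subseteq> AdS ix" by (auto simp: wedge_def)
  ultimately show ?thesis
    by (auto simp: W_KMS_def alpha_in_tube_iff[OF assms])
qed

text \<open>
  Multiplication by \<open>- \<i>\<close> on the coordinates 1 and 2, combined with their exchange, turns purely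
  imaginary entries into real ones.
\<close>
lemma tau_bar_fixed_iff:
  assumes "ix 1 \<noteq> ix 2"
  shows "tau_bar ix z = z \<longleftrightarrow> kappa_h ix z \<in> range complexify"
proof -
  have "tau_bar ix z = z \<longleftrightarrow> (\<forall>j. Im (kappa_h ix z $ j) = 0)"
  proof -
    have "tau_bar ix z = z \<longleftrightarrow> Re (z $ ix 1) = 0 \<and> Re (z $ ix 2) = 0
        \<and> (\<forall>j. j \<noteq> ix 1 \<and> j \<noteq> ix 2 \<longrightarrow> Im (z $ j) = 0)"
      using assms
      by (simp add: tau_bar_def tau_h_eq vec_eq_iff cnj_vec_def complex_eq_iff)
        (metis neg_equal_zero)
    also have "\<dots> \<longleftrightarrow> (\<forall>j. Im (kappa_h ix z $ j) = 0)"
      using assms by (auto simp: kappa_h_eq)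
    finally show ?thesis .
  qed
  also have "\<dots> \<longleftrightarrow> kappa_h ix z \<in> range complexify"
  proof
    assume "\<forall>j. Im (kappa_h ix z $ j) = 0"
    then have "kappa_h ix z = complexify (re_part (kappa_h ix z))"
      by (simp add: vec_eq_iff complexify_def re_part_def complex_eq_iff)
    then show "kappa_h ix z \<in> range complexify" by blast
  qed (auto simp: complexify_def)
  finally show ?thesis .
qed

text \<open>
  The inverse of \<open>\<kappa>\<^sub>h\<close> belongs to the flow, with parameter \<open>\<i>\<pi>/2\<close>; this reduces the statement
  on the tube domain to the KMS computation.
\<close>
lemma kappa_h_eq_iff_alpha:
  assumes "ix 1 \<noteq> ix 2"
  shows "kappa_h ix z = w \<longleftrightarrow> z = alpha ix (\<i> * of_real (pi / 2)) w"
proof -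
  have "cosh (\<i> * of_real (pi / 2)) = 0" "sinh (\<i> * of_real (pi / 2)) = \<i>"
    unfolding cosh_imaginary sinh_imaginary by simp_all
  then have "alpha ix (\<i> * of_real (pi / 2)) w
      = (\<chi> j. if j = ix 1 then \<i> * w $ ix 2 else if j = ix 2 then \<i> * w $ ix 1 else w $ j)"
    by (simp only: alpha_eq[of ix, OF assms]) (simp add: vec_eq_iff)
  moreover have "- \<i> * a = b \<longleftrightarrow> a = \<i> * b" for a b :: complex
    by (auto simp: complex_eq_iff)
  ultimately show ?thesis
    using assms by (auto simp: kappa_h_eq vec_eq_iff)
qed

lemma kappa_h_tube_fixed:
  assumes dist: "distinct [ix 0, ix 1, ix 2]"
  shows "kappa_h ix ` tube_fixed ix = complexify ` wedge ix"
proof -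
  have ne: "ix 1 \<noteq> ix 2" using dist by simp
  let ?a = "alpha ix (\<i> * of_real (pi / 2))"
  have k: "kappa_h ix z = w \<longleftrightarrow> z = ?a w" for z w
    by (rule kappa_h_eq_iff_alpha[OF ne])
  then have inv: "kappa_h ix (?a w) = w" for w by blast
  have image: "w \<in> kappa_h ix ` tube_fixed ix \<longleftrightarrow> ?a w \<in> tube_fixed ix" for w
  proof
    assume "w \<in> kappa_h ix ` tube_fixed ix"
    then obtain z where "z \<in> tube_fixed ix" "kappa_h ix z = w" by blast
    then show "?a w \<in> tube_fixed ix" using k[of z w] by simp
  next
    assume "?a w \<in> tube_fixed ix"
    then show "w \<in> kappa_h ix ` tube_fixed ix"
      by (rule image_eqI[where f = "kappa_h ix", OF inv[symmetric]])
  qed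
  have fixed: "?a w \<in> tube_fixed ix \<longleftrightarrow> w \<in> range complexify \<and> ?a w \<in> tube ix" for w
    unfolding tube_fixed_def mem_Collect_eq tau_bar_fixed_iff[OF ne] inv by blast
  have wedge: "?a (complexify x) \<in> tube ix \<longleftrightarrow> x \<in> wedge ix" for x
    by (rule alpha_in_tube_iff[OF dist]) simp
  show ?thesis
  proof (intro set_eqI iffI)
    fix w assume "w \<in> kappa_h ix ` tube_fixed ix"
    then obtain x where "w = complexify x" "?a w \<in> tube ix"
      unfolding image fixed by blast
    then show "w \<in> complexify ` wedge ix" using wedge[of x] by (simp only: imageI)
  next
    fix w assume "w \<in> complexify ` wedge ix"
    then obtain x where x: "w = complexify x" "x \<in> wedge ix" by blast
    then have "?a w \<in> tube ix" using wedge[of x] by (simp only:)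
    then show "w \<in> kappa_h ix ` tube_fixed ix"
      unfolding image fixed using x(1) by (intro conjI) (simp_all only: rangeI)
  qed
qed


section \<open>The wedge as a union of exponentiated cones\<close>

definition plane_vec :: "(nat \<Rightarrow> 'n::finite) \<Rightarrow> real \<Rightarrow> real \<Rightarrow> real ^ 'n" where
  "plane_vec ix a b = (\<chi> j. if j = ix 1 then a else if j = ix 2 then b else 0)"

lemma plane_vec_nth:
  assumes "distinct [ix 0, ix 1, ix 2]"
  shows "plane_vec ix a b $ ix 0 = 0" "plane_vec ix a b $ ix 1 = a" "plane_vec ix a b $ ix 2 = b"
  using assms by (auto simp: plane_vec_def)

lemma plane_vec_eq_iff:
  assumes "distinct [ix 0, ix 1, ix 2]"
  shows "plane_vec ix a b = plane_vec ix a' b' \<longleftrightarrow> a = a' \<and> b = b'"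
  by (metis plane_vec_nth[OF assms])

lemma plane_vec_add: "plane_vec ix a b + plane_vec ix a' b' = plane_vec ix (a + a') (b + b')"
  and plane_vec_diff: "plane_vec ix a b - plane_vec ix a' b' = plane_vec ix (a - a') (b - b')"
  and scaleR_plane_vec: "k *\<^sub>R plane_vec ix a b = plane_vec ix (k * a) (k * b)"
  by (auto simp: plane_vec_def vec_eq_iff)

lemma euler_h_plane_vec:
  assumes "distinct [ix 0, ix 1, ix 2]"
  shows "euler_h ix (plane_vec ix a b) = plane_vec ix b a"
  using assms by (auto simp: euler_h_def plane_vec_def vec_eq_iff)

lemma beta_plane_vec:
  assumes "distinct [ix 0, ix 1, ix 2]"
  shows "\<beta> ix (plane_vec ix a b) (plane_vec ix a b) = a\<^sup>2 - b\<^sup>2"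
proof -
  have "(\<Sum>j\<in>UNIV - {ix 0, ix 1, ix 2}. plane_vec ix a b $ j * plane_vec ix a b $ j) = 0"
    by (intro sum.neutral) (auto simp: plane_vec_def)
  then show ?thesis
    by (simp add: beta_split[OF assms] plane_vec_nth[OF assms] power2_eq_square)
qed

text \<open>
  Averaging the equations for \<open>\<alpha>\<^sub>1\<close> and \<open>\<alpha>\<^bsub>-1\<^esub>\<close> leaves the factor \<open>cosh 1\<close>, which differs
  from \<open>1\<close>.
\<close>
lemma fixed_points_iff:
  assumes dist: "distinct [ix 0, ix 1, ix 2]"
  shows "m \<in> fixed_points ix \<longleftrightarrow> m \<in> AdS ix \<and> m $ ix 1 = 0 \<and> m $ ix 2 = 0"
proof
  have ne: "ix 1 \<noteq> ix 2" using dist by simp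
  assume m: "m \<in> fixed_points ix"
  have "complex_of_real (cosh t * m $ ix 1 + sinh t * m $ ix 2) = complex_of_real (m $ ix 1)
     \<and> complex_of_real (sinh t * m $ ix 1 + cosh t * m $ ix 2) = complex_of_real (m $ ix 2)" for t
  proof -
    have "alpha ix (of_real t) (complexify m) = complexify m"
      using m by (simp add: fixed_points_def)
    then have "alpha ix (of_real t) (complexify m) $ ix 1 = complexify m $ ix 1"
      "alpha ix (of_real t) (complexify m) $ ix 2 = complexify m $ ix 2" by simp_all
    moreover have "cosh (complex_of_real t) = of_real (cosh t)" "sinh (complex_of_real t) = of_real (sinh t)"
      by (simp_all add: cosh_def sinh_def scaleR_conv_of_real exp_of_real flip: of_real_minus)
    ultimately show ?thesis using ne by (simp add: alpha_eq complexify_def)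
  qed
  then have e: "cosh t * m $ ix 1 + sinh t * m $ ix 2 = m $ ix 1"
    "sinh t * m $ ix 1 + cosh t * m $ ix 2 = m $ ix 2" for t
    unfolding of_real_eq_iff by blast+
  have "(cosh 1 - 1) * m $ ix 1 = 0" "(cosh 1 - 1) * m $ ix 2 = 0"
    using e[of 1] e[of "-1"] by (simp_all add: algebra_simps)
  moreover have "cosh (1::real) \<noteq> 1"
    using cosh_real_strict_mono[of 0 1] by simp
  ultimately show "m \<in> AdS ix \<and> m $ ix 1 = 0 \<and> m $ ix 2 = 0"
    using m by (simp add: fixed_points_def)
next
  have ne: "ix 1 \<noteq> ix 2" using dist by simp
  assume "m \<in> AdS ix \<and> m $ ix 1 = 0 \<and> m $ ix 2 = 0"
  then show "m \<in> fixed_points ix"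
    by (simp add: fixed_points_def alpha_eq[OF ne] vec_eq_iff complexify_def)
qed

lemma fixed_point_nonzero:
  assumes dist: "distinct [ix 0, ix 1, ix 2]" and m: "m \<in> fixed_points ix"
  shows "m $ ix 0 \<noteq> 0"
proof
  assume "m $ ix 0 = 0"
  then have "\<beta> ix m m \<le> 0" using m by (intro beta_nonpos) (simp_all add: fixed_points_iff[OF dist])
  then show False using m by (simp add: fixed_points_def AdS_def)
qed

lemma beta_fixed_point_plane_vec:
  assumes dist: "distinct [ix 0, ix 1, ix 2]" and m: "m \<in> fixed_points ix"
  shows "\<beta> ix m (plane_vec ix a b) = 0"
proof -
  have "(\<Sum>j\<in>UNIV - {ix 0, ix 1, ix 2}. m $ j * plane_vec ix a b $ j) = 0"
    by (intro sum.neutral) (auto simp: plane_vec_def)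
  then show ?thesis
    using m by (simp add: beta_split[OF dist] plane_vec_nth[OF dist] fixed_points_iff[OF dist])
qed

lemma tangent_eigen_eq:
  assumes dist: "distinct [ix 0, ix 1, ix 2]" and m: "m \<in> fixed_points ix" and k: "k = 1 \<or> k = - 1"
  shows "tangent_eigen ix m k = range (\<lambda>s. plane_vec ix s (k * s))"
proof (intro set_eqI iffI)
  fix v assume "v \<in> tangent_eigen ix m k"
  then have e: "euler_h ix v $ j = k * v $ j" for j by (simp add: tangent_eigen_def)
  have "v $ ix 2 = k * v $ ix 1" using e[of "ix 1"] by (simp add: euler_h_def)
  moreover have "v $ j = 0" if "j \<noteq> ix 1" "j \<noteq> ix 2" for j
    using e[of j] that k by (auto simp: euler_h_def)
  ultimately have "v = plane_vec ix (v $ ix 1) (k * v $ ix 1)" by (simp add: vec_eq_iff plane_vec_def)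
  then show "v \<in> range (\<lambda>s. plane_vec ix s (k * s))" by blast
next
  fix v assume "v \<in> range (\<lambda>s. plane_vec ix s (k * s))"
  then show "v \<in> tangent_eigen ix m k"
    using k dist by (auto simp: tangent_eigen_def tangent_def beta_fixed_point_plane_vec[OF dist m]
      euler_h_plane_vec scaleR_plane_vec)
qed

text \<open>
  The eigenvectors of \<open>h\<close> for the eigenvalues \<open>\<plusminus>1\<close> are lightlike, so they can only lie on the
  boundary of the cone. Adding \<open>\<epsilon> m\<^sub>0 e\<^sub>1\<close> with \<open>\<epsilon> > 0\<close> pushes such a vector into the cone.
\<close>
lemma lightlike_closure_Vplus_iff:
  assumes dist: "distinct [ix 0, ix 1, ix 2]" and m: "m \<in> fixed_points ix" and ab: "a\<^sup>2 = b\<^sup>2"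
  shows "plane_vec ix a b \<in> closure (Vplus ix m) \<longleftrightarrow> m $ ix 0 * a \<ge> 0"
proof
  have ne: "ix 0 \<noteq> ix 1" using dist by simp
  have mA: "m \<in> AdS ix" "m $ ix 1 = 0" using m by (simp_all add: fixed_points_iff[OF dist])
  {
    assume "plane_vec ix a b \<in> closure (Vplus ix m)"
    moreover have "Vplus ix m \<subseteq> {v. 0 \<le> orient ix m v}"
      using Vplus_iff[OF ne mA(1)] by auto
    moreover have "closed {v. 0 \<le> orient ix m v}"
      unfolding orient_def by (intro closed_Collect_le continuous_intros)
    ultimately have "orient ix m (plane_vec ix a b) \<ge> 0"
      using closure_minimal by blast
    then show "m $ ix 0 * a \<ge> 0" by (simp add: orient_def plane_vec_nth[OF dist])
  next
    assume a: "m $ ix 0 * a \<ge> 0"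
    have m0: "m $ ix 0 \<noteq> 0" by (rule fixed_point_nonzero[OF dist m])
    have in_V: "plane_vec ix (a + e * m $ ix 0) b \<in> Vplus ix m" if "e > 0" for e
    proof -
      have "(a + e * m $ ix 0)\<^sup>2 - b\<^sup>2 = 2 * e * (m $ ix 0 * a) + (e * m $ ix 0)\<^sup>2"
        using ab by (simp add: power2_eq_square algebra_simps)
      moreover have "\<dots> > 0" using a m0 that by (intro add_nonneg_pos) simp_all
      moreover have "m $ ix 0 * (a + e * m $ ix 0) > 0"
      proof -
        have "e * (m $ ix 0 * m $ ix 0) > 0" using that m0 by (simp add: zero_less_mult_iff) linarith
        then show ?thesis using a by (simp add: algebra_simps)
      qed
      ultimately show ?thesis
        by (simp add: Vplus_iff[OF ne mA(1)] beta_fixed_point_plane_vec[OF dist m]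
          beta_plane_vec[OF dist] orient_def plane_vec_nth[OF dist] mA)
    qed
    have "((\<lambda>e. plane_vec ix (a + e * m $ ix 0) b) \<longlongrightarrow> plane_vec ix a b) (at_right 0)"
    proof (rule vec_tendstoI)
      fix j
      have "((\<lambda>e. a + e * m $ ix 0) \<longlongrightarrow> a) (at_right 0)"
        by (auto intro!: tendsto_eq_intros)
      then show "((\<lambda>e. plane_vec ix (a + e * m $ ix 0) b $ j) \<longlongrightarrow> plane_vec ix a b $ j) (at_right 0)"
        by (auto simp: plane_vec_def)
    qed
    moreover have "\<forall>\<^sub>F e in at_right 0. plane_vec ix (a + e * m $ ix 0) b \<in> closure (Vplus ix m)"
      using in_V[THEN subsetD[OF closure_subset]] by (auto intro!: eventually_at_rightI[of 0 1])
    ultimately show "plane_vec ix a b \<in> closure (Vplus ix m)"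
      by (intro Lim_in_closed_set[OF closed_closure]) auto
  }
qed

text \<open>
  The inequalities are \<open>m\<^sub>0 s \<ge> 0\<close> and \<open>m\<^sub>0 r \<ge> 0\<close> in the lightcone coordinates
  \<open>s = (b + a) / 2\<close> and \<open>r = (b - a) / 2\<close>, that is, for the decomposition of \<open>a e\<^sub>1 + b e\<^sub>2\<close>
  as \<open>s (e\<^sub>1 + e\<^sub>2) - r (e\<^sub>1 - e\<^sub>2)\<close>.
\<close>
lemma cone_c_eq:
  assumes dist: "distinct [ix 0, ix 1, ix 2]" and m: "m \<in> fixed_points ix"
  shows "cone_c ix m = {plane_vec ix a b |a b. m $ ix 0 * (b + a) \<ge> 0 \<and> m $ ix 0 * (b - a) \<ge> 0}"
proof -
  have cone: "closure (Vplus ix m) \<inter> tangent_eigen ix m k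
      = {plane_vec ix s (k * s) |s. m $ ix 0 * s \<ge> 0}" if "k = 1 \<or> k = - 1" for k
  proof -
    have "s\<^sup>2 = (k * s)\<^sup>2" for s using that by auto
    then show ?thesis
      by (auto simp: tangent_eigen_eq[OF dist m that] lightlike_closure_Vplus_iff[OF dist m])
  qed
  have d: "plane_vec ix (s - r) (s + r) = plane_vec ix s s - plane_vec ix r (- r)" for s r
    by (simp add: plane_vec_diff)
  have "cone_c ix m
      = {plane_vec ix (s - r) (s + r) |s r. m $ ix 0 * s \<ge> 0 \<and> m $ ix 0 * r \<ge> 0}"
    unfolding cone_c_def cone[of 1, simplified] cone[of "- 1", simplified] d
    by blast
  also have "\<dots> = {plane_vec ix a b |a b. m $ ix 0 * (b + a) \<ge> 0 \<and> m $ ix 0 * (b - a) \<ge> 0}"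
  proof (intro set_eqI iffI; clarsimp)
    fix s r assume "0 \<le> m $ ix 0 * s" "0 \<le> m $ ix 0 * r"
    then show "\<exists>a b. plane_vec ix (s - r) (s + r) = plane_vec ix a b
        \<and> 0 \<le> m $ ix 0 * (b + a) \<and> 0 \<le> m $ ix 0 * (b - a)"
      by - (rule exI[of _ "s - r"], rule exI[of _ "s + r"], simp add: mult.commute)
  next
    fix a b assume "0 \<le> m $ ix 0 * (b + a)" "0 \<le> m $ ix 0 * (b - a)"
    moreover have "a = (b + a) / 2 - (b - a) / 2" "b = (b + a) / 2 + (b - a) / 2"
      by (simp_all add: field_simps)
    ultimately show "\<exists>s r. plane_vec ix a b = plane_vec ix (s - r) (s + r)
        \<and> 0 \<le> m $ ix 0 * s \<and> 0 \<le> m $ ix 0 * r"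
      by - (rule exI[of _ "(b + a) / 2"], rule exI[of _ "(b - a) / 2"], simp)
  qed
  finally show ?thesis .
qed

text \<open>
  The strict inequalities define a relatively open subset of the cone. It is all of the
  interior: from an interior point one can move a little in the direction \<open>- m\<^sub>0 e\<^sub>2\<close> without
  leaving the cone, and this decreases both expressions strictly.
\<close>
lemma cone_c0_eq:
  assumes dist: "distinct [ix 0, ix 1, ix 2]" and m: "m \<in> fixed_points ix"
  shows "cone_c0 ix m = {plane_vec ix a b |a b. m $ ix 0 * (b + a) > 0 \<and> m $ ix 0 * (b - a) > 0}"
    (is "_ = ?O")
proof -
  define E where "E = {plane_vec ix a b |a b. True}"
  have "{v + w |v w. v \<in> tangent_eigen ix m 1 \<and> w \<in> tangent_eigen ix m (- 1)} = E"
  proof (intro set_eqI iffI)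
    fix u assume "u \<in> E"
    then obtain a b where u: "u = plane_vec ix a b" by (auto simp: E_def)
    have "u = plane_vec ix ((a + b) / 2) ((a + b) / 2) + plane_vec ix ((a - b) / 2) (- ((a - b) / 2))"
      by (simp add: u plane_vec_add field_simps)
    then show "u \<in> {v + w |v w. v \<in> tangent_eigen ix m 1 \<and> w \<in> tangent_eigen ix m (- 1)}"
      using tangent_eigen_eq[OF dist m, of 1] tangent_eigen_eq[OF dist m, of "- 1"] by force
  qed (auto simp: tangent_eigen_eq[OF dist m] E_def plane_vec_add, blast)
  then have c0: "cone_c0 ix m = top_of_set E interior_of cone_c ix m"
    by (simp add: cone_c0_def)
  show ?thesis
  proof (rule equalityI)
    have "?O = E \<inter> {v. 0 < m $ ix 0 * (v $ ix 2 + v $ ix 1) \<and> 0 < m $ ix 0 * (v $ ix 2 - v $ ix 1)}"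
      by (auto simp: E_def plane_vec_nth[OF dist], blast)
    moreover have "open {v. 0 < m $ ix 0 * (v $ ix 2 + v $ ix 1) \<and> 0 < m $ ix 0 * (v $ ix 2 - v $ ix 1)}"
      by (intro open_Collect_conj open_Collect_less continuous_intros)
    ultimately have "openin (top_of_set E) ?O" by (simp add: openin_open) blast
    moreover have "?O \<subseteq> cone_c ix m"
      unfolding cone_c_eq[OF dist m] by (blast intro: less_imp_le)
    ultimately show "?O \<subseteq> cone_c0 ix m" unfolding c0 by (simp add: interior_of_maximal)
  next
    show "cone_c0 ix m \<subseteq> ?O"
    proof
      fix v assume "v \<in> cone_c0 ix m"
      then obtain T where T: "openin (top_of_set E) T" "v \<in> T" "T \<subseteq> cone_c ix m"
        unfolding c0 interior_of_def by blast
      then obtain a b where v: "v = plane_vec ix a b"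
        using openin_imp_subset[OF T(1)] by (auto simp: E_def)
      obtain U where U: "open U" "T = E \<inter> U" using T(1) by (auto simp: openin_open)
      have "((\<lambda>e. plane_vec ix a (b - e * m $ ix 0)) \<longlongrightarrow> plane_vec ix a b) (at_right 0)"
      proof (rule vec_tendstoI)
        fix j
        have "((\<lambda>e. b - e * m $ ix 0) \<longlongrightarrow> b) (at_right 0)"
          by (auto intro!: tendsto_eq_intros)
        then show "((\<lambda>e. plane_vec ix a (b - e * m $ ix 0) $ j) \<longlongrightarrow> plane_vec ix a b $ j) (at_right 0)"
          by (auto simp: plane_vec_def)
      qed
      then have "\<forall>\<^sub>F e in at_right 0. plane_vec ix a (b - e * m $ ix 0) \<in> U"
        by (rule topological_tendstoD) (use U T v in auto)
      moreover have "\<forall>\<^sub>F e in at_right (0::real). e > 0"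
        by (rule eventually_at_right_less)
      ultimately have "\<forall>\<^sub>F e in at_right 0. plane_vec ix a (b - e * m $ ix 0) \<in> U \<and> e > 0"
        by (rule eventually_conj)
      \<comment> \<open>An admissible step length for moving in the direction \<open>- m\<^sub>0 e\<^sub>2\<close>.\<close>
      then obtain e where e: "plane_vec ix a (b - e * m $ ix 0) \<in> U" "e > 0"
        using eventually_happens'[of "at_right (0::real)"] by (auto simp: trivial_limit_at_right_real)
      then have "plane_vec ix a (b - e * m $ ix 0) \<in> cone_c ix m"
        using U T(3) by (auto simp: E_def)
      then have "m $ ix 0 * (b - e * m $ ix 0 + a) \<ge> 0" "m $ ix 0 * (b - e * m $ ix 0 - a) \<ge> 0"
        by (auto simp: cone_c_eq[OF dist m] plane_vec_eq_iff[OF dist])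
      moreover have "e * (m $ ix 0 * m $ ix 0) > 0"
        using e(2) fixed_point_nonzero[OF dist m] by (simp add: zero_less_mult_iff) linarith
      ultimately have "m $ ix 0 * (b + a) > 0 \<and> m $ ix 0 * (b - a) > 0"
        by (simp add: algebra_simps)
      then show "v \<in> ?O" using v by blast
    qed
  qed
qed

text \<open>
  The two expressions on the left have sum \<open>2 m b\<close> and product \<open>m\<^sup>2 (b\<^sup>2 - a\<^sup>2)\<close>.
\<close>
lemma strict_cone_iff:
  fixes m a b :: real
  shows "m * (b + a) > 0 \<and> m * (b - a) > 0 \<longleftrightarrow> m * b > 0 \<and> a\<^sup>2 < b\<^sup>2"
proof (cases "m = 0")
  case False
  have prod: "(m * (b + a)) * (m * (b - a)) = m\<^sup>2 * (b\<^sup>2 - a\<^sup>2)"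
    by (simp add: power2_eq_square algebra_simps)
  have sum: "m * (b + a) + m * (b - a) = 2 * (m * b)"
    by (simp add: algebra_simps)
  have "a\<^sup>2 < b\<^sup>2 \<longleftrightarrow> (m * (b + a)) * (m * (b - a)) > 0"
    unfolding prod using False by (simp add: zero_less_mult_iff)
  then show ?thesis using sum by (auto simp: zero_less_mult_iff[of "m * (b + a)" "m * (b - a)"])
qed simp

text \<open>
  Here \<open>\<beta>(v, v)\<close> is the square of \<open>\<i> r\<close>, so \<open>cos\<close> and \<open>sin\<close> become \<open>cosh\<close> and \<open>sinh\<close>.
\<close>
lemma Exp_spacelike:
  assumes "\<beta> ix v v = - r\<^sup>2" "r > 0"
  shows "Exp ix m v = cosh r *\<^sub>R m + (sinh r / r) *\<^sub>R v"
proof -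
  have sq: "complex_of_real (\<beta> ix v v) = (\<i> * of_real r)\<^sup>2"
    by (simp add: assms power_mult_distrib)
  have "cos (\<i> * of_real r) = complex_of_real (cosh r)"
    "sin (\<i> * of_real r) = \<i> * complex_of_real (sinh r)"
    by (simp_all add: cos_exp_eq sin_exp_eq cosh_def sinh_def exp_of_real scaleR_conv_of_real
      field_simps flip: of_real_minus)
  then show ?thesis
    using assms(2) by (simp add: Exp_def sq entire_C_square entire_S_square)
qed

text \<open>
  A point \<open>x\<close> of the wedge has hyperbolic polar coordinates: \<open>sinh r\<close> is the hyperbolic length of
  \<open>(x\<^sub>1, x\<^sub>2)\<close>, the remaining coordinates divided by \<open>cosh r\<close> give the fixed point \<open>m\<close>, and
  \<open>(x\<^sub>1, x\<^sub>2)\<close> rescaled to hyperbolic length \<open>r\<close> gives the tangent vector.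
\<close>
lemma W_M_eq_wedge:
  assumes dist: "distinct [ix 0, ix 1, ix 2]"
  shows "W_M ix = wedge ix"
proof (intro equalityI subsetI)
  fix x assume "x \<in> W_M ix"
  then obtain m v where m: "m \<in> fixed_points ix" and v: "v \<in> cone_c0 ix m" and x: "x = Exp ix m v"
    by (auto simp: W_M_def)
  obtain a b where ab: "v = plane_vec ix a b" "m $ ix 0 * b > 0" "a\<^sup>2 < b\<^sup>2"
    using v unfolding cone_c0_eq[OF dist m] by (auto simp: strict_cone_iff)
  define r where "r = sqrt (b\<^sup>2 - a\<^sup>2)"
  have r: "r > 0" "r\<^sup>2 = b\<^sup>2 - a\<^sup>2" using ab by (simp_all add: r_def)
  define c s where "c = cosh r" and "s = sinh r / r"
  have cs: "c > 0" "s > 0" "c * c - s * s * r\<^sup>2 = 1"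
    using r(1) cosh_square_eq[of r] by (simp_all add: c_def s_def power2_eq_square)
  have vv: "\<beta> ix v v = - r\<^sup>2" using r by (simp add: ab beta_plane_vec[OF dist])
  have xm: "x = c *\<^sub>R m + s *\<^sub>R v"
    unfolding x c_def s_def by (rule Exp_spacelike[OF vv r(1)])
  have mA: "\<beta> ix m m = 1" "m $ ix 1 = 0" "m $ ix 2 = 0"
    using m by (simp_all add: fixed_points_iff[OF dist] AdS_def)
  have mv: "\<beta> ix m v = 0" "\<beta> ix v m = 0"
    using beta_fixed_point_plane_vec[OF dist m] by (simp_all add: ab beta_commute[of ix "plane_vec ix a b" m])
  have "\<beta> ix x x = c * c - s * s * r\<^sup>2"
    by (simp add: xm beta_bilinear mA mv vv)
  then have "x \<in> AdS ix" using cs by (simp add: AdS_def)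
  moreover have "x $ ix 0 * x $ ix 2 > 0"
  proof -
    have "x $ ix 0 * x $ ix 2 = (c * s) * (m $ ix 0 * b)"
      by (simp add: xm ab mA plane_vec_nth[OF dist])
    also have "\<dots> > 0" by (intro mult_pos_pos cs ab)
    finally show ?thesis .
  qed
  moreover have "(x $ ix 1)\<^sup>2 < (x $ ix 2)\<^sup>2"
    using cs ab by (simp add: xm mA plane_vec_nth[OF dist] power_mult_distrib)
  ultimately show "x \<in> wedge ix" by (simp add: wedge_def)
next
  fix x assume xw: "x \<in> wedge ix"
  then have x: "\<beta> ix x x = 1" "x $ ix 0 * x $ ix 2 > 0" "(x $ ix 1)\<^sup>2 < (x $ ix 2)\<^sup>2"
    by (auto simp: wedge_def AdS_def)
  define r where "r = arsinh (sqrt ((x $ ix 2)\<^sup>2 - (x $ ix 1)\<^sup>2))"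
  have sh: "sinh r = sqrt ((x $ ix 2)\<^sup>2 - (x $ ix 1)\<^sup>2)" by (simp add: r_def sinh_arsinh_real)
  have "sinh r > 0" using x by (simp add: sh)
  then have r: "r > 0" by simp
  have sh2: "(sinh r)\<^sup>2 = (x $ ix 2)\<^sup>2 - (x $ ix 1)\<^sup>2" using x by (simp add: sh)
  define c s where "c = cosh r" and "s = sinh r / r"
  have cs: "c > 0" "s > 0" using r by (simp_all add: c_def s_def)
  have c2: "c\<^sup>2 = 1 + (x $ ix 2)\<^sup>2 - (x $ ix 1)\<^sup>2"
    using cosh_square_eq[of r] by (simp add: c_def sh2)
  define m where "m = (1 / c) *\<^sub>R (x - plane_vec ix (x $ ix 1) (x $ ix 2))"
  define v where "v = plane_vec ix (x $ ix 1 / s) (x $ ix 2 / s)"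
  let ?p = "plane_vec ix (x $ ix 1) (x $ ix 2)"
  have m12: "m $ ix 0 = x $ ix 0 / c" "m $ ix 1 = 0" "m $ ix 2 = 0"
    by (simp_all add: m_def plane_vec_nth[OF dist])
  have "(\<Sum>j\<in>UNIV - {ix 0, ix 1, ix 2}. x $ j * ?p $ j) = 0"
    by (intro sum.neutral) (auto simp: plane_vec_def)
  then have "\<beta> ix x ?p = (x $ ix 1)\<^sup>2 - (x $ ix 2)\<^sup>2"
    by (simp add: beta_split[OF dist] plane_vec_nth[OF dist] power2_eq_square)
  then have "\<beta> ix (x - ?p) (x - ?p) = c\<^sup>2"
    using beta_commute[of ix ?p x]
    by (simp add: beta_bilinear x beta_plane_vec[OF dist] c2)
  then have "\<beta> ix m m = 1"
    using cs by (simp add: m_def beta_scaleR_left beta_scaleR_right power2_eq_square)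
  then have m: "m \<in> fixed_points ix" by (simp add: fixed_points_iff[OF dist] AdS_def m12)
  have "\<beta> ix v v = - ((x $ ix 2)\<^sup>2 - (x $ ix 1)\<^sup>2) / s\<^sup>2"
    by (simp add: v_def beta_plane_vec[OF dist] power_divide diff_divide_distrib)
  also have "\<dots> = - r\<^sup>2"
    using r \<open>sinh r > 0\<close> by (simp add: s_def power_divide sh2[symmetric])
  finally have "Exp ix m v = c *\<^sub>R m + s *\<^sub>R v"
    unfolding c_def s_def by (rule Exp_spacelike[OF _ r])
  also have "\<dots> = x"
  proof -
    have "s *\<^sub>R v = ?p" using cs by (simp add: v_def plane_vec_def vec_eq_iff)
    moreover have "c *\<^sub>R m = x - ?p" using cs by (simp add: m_def)
    ultimately show ?thesis by simp
  qed
  finally have Ex: "x = Exp ix m v" by simp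
  have "m $ ix 0 * (x $ ix 2 / s) = (x $ ix 0 * x $ ix 2) / (c * s)" by (simp add: m12)
  also have "\<dots> > 0" by (intro divide_pos_pos mult_pos_pos[OF cs] x)
  finally have "m $ ix 0 * (x $ ix 2 / s) > 0" .
  moreover have "(x $ ix 1 / s)\<^sup>2 < (x $ ix 2 / s)\<^sup>2"
    using x cs by (simp add: power_divide divide_strict_right_mono)
  ultimately have "v \<in> cone_c0 ix m"
    unfolding cone_c0_eq[OF dist m] v_def strict_cone_iff by blast
  with m Ex show "x \<in> W_M ix" by (auto simp: W_M_def)
qed


section \<open>Equality of the wedge domains\<close>

theorem theorem11p6:
  fixes d :: nat and ix :: "nat \<Rightarrow> 'n::finite"
  assumes "d \<ge> 2" and "bij_betw ix {0..d} UNIV"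
  shows "W_plus ix = W_KMS ix
    \<and> complexify ` W_KMS ix = kappa_h ix ` tube_fixed ix
    \<and> kappa_h ix ` tube_fixed ix = complexify ` W_M ix"
proof -
  have "inj_on ix {0..d}" using assms(2) by (rule bij_betw_imp_inj_on)
  then have "distinct [ix 0, ix 1, ix 2]"
    using assms(1) by (auto simp: inj_on_eq_iff)
  then show ?thesis
    by (simp add: W_plus_eq_wedge W_KMS_eq_wedge W_M_eq_wedge kappa_h_tube_fixed)
qed

end
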